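(* Let $p\ge 2$, let $X_1,X_2,\dots$ be i.i.d. from a known continuous distribution $F$ on $\mathbb{R}^p$, and let $D$ be a data depth. Let $\beta,\gamma\in(0,1)$ and let $\xi_\gamma$ be the $\gamma$-quantile of the standard normal distribution, i.e. $\Phi(\xi_\gamma)=\gamma$. For each $n$ let $r_n\in\{1,\dots,n\}$, and let $O_{Z^{[r_n]}}=\{x\in\mathbb{R}^p:D_F(x)>Z^{[r_n]}\}$ be the tolerance region based on $X_1,\dots,X_n$. As $n\to\infty$, if $r_n$ satisfies $$\sqrt n\left(\frac{r_n}{n}-\beta\right)\to \xi_\gamma\sqrt{\beta(1-\beta)},$$ then $$P\bigl(P_F(O_{Z^{[r_n]}})\ge\beta\bigr)\to\gamma .$$
   Context: A data depth $D$ assigns to each distribution $F$ on $\mathbb{R}^p$ a function $D_F:\mathbb{R}^p\to[0,\infty)$, where $D_F(x)$ measures how deep (central) $x$ is with respect to $F$. For each $n$, put $Z_i=D_F(X_i)$, $i=1,\dots,n$, and let $Z^{[1]}\ge\dots\ge Z^{[n]}$ be these values in descending order. $P_F$ denotes probability under $F$; $P_F(O_{Z^{[r_n]}})$ is the $F$-measure of the random region given the sample, and the outer $P$ refers to the distribution of the sample. $\Phi$ is the standard normal distribution function.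
   Formalization: Added: D_F is Borel measurable and D_F(X_1) has a continuous (atomless) distribution. Without the latter the claim fails: for constant D_F every region is empty, so the probability is 0. "Continuous F" is read as atomless. *)

theory Defs
  imports "HOL-Probability.Probability"
begin

definition prob_distribution :: "('a::topological_space) measure \<Rightarrow> bool" where
  "prob_distribution F \<longleftrightarrow> prob_space F \<and> sets F = sets borel"

text \<open>
  ``Continuous'' is read as ``without atoms''. This is the weakest of the usual readings in
  several dimensions: it is implied both by continuity of the joint distribution function and by
  the existence of a density.
\<close>
definition continuous_distribution :: "('a::topological_space) measure \<Rightarrow> bool" where
  "continuous_distribution F \<longleftrightarrow> prob_distribution F \<and> (\<forall>x. measure F {x} = 0)"

text \<open>
  No axiom beyond nonnegativity (such as affine invariance or monotonicity along rays) is imposed.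
  The values of \<open>D\<close> on measures that are not probability distributions are irrelevant.
\<close>
definition data_depth :: "(('a::topological_space) measure \<Rightarrow> 'a \<Rightarrow> real) \<Rightarrow> bool" where
  "data_depth D \<longleftrightarrow> (\<forall>F. prob_distribution F \<longrightarrow> (\<forall>x. 0 \<le> D F x))"

text \<open>
  The \<open>r\<close>-th largest of \<open>z 1, \<dots>, z n\<close>, counted with multiplicity; meaningful for
  \<open>1 \<le> r \<le> n\<close>. List positions start at 0, hence the shift.
\<close>
definition desc_order_stat :: "(nat \<Rightarrow> real) \<Rightarrow> nat \<Rightarrow> nat \<Rightarrow> real" where
  "desc_order_stat z n r = rev (sort (map z [1..<Suc n])) ! (r - 1)"

definition depth_region :: "('a measure \<Rightarrow> 'a \<Rightarrow> real) \<Rightarrow> 'a measure \<Rightarrow> real \<Rightarrow> 'a set" where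
  "depth_region D F t = {x. D F x > t}"

definition tolerance_region ::
  "('a measure \<Rightarrow> 'a \<Rightarrow> real) \<Rightarrow> 'a measure \<Rightarrow> (nat \<Rightarrow> 'a) \<Rightarrow> nat \<Rightarrow> nat \<Rightarrow> 'a set" where
  "tolerance_region D F x n r = depth_region D F (desc_order_stat (\<lambda>i. D F (x i)) n r)"

end

theory Submission
  imports Defs
begin

text \<open>
  Let \<open>q\<close> be the largest level whose depth region has \<open>F\<close>-measure at least \<open>\<beta>\<close>. Since the depth
  has a continuous law, this measure is exactly \<open>\<beta>\<close>, and the tolerance region has measure at least
  \<open>\<beta>\<close> iff the \<open>r n\<close>-th largest sample depth is at most \<open>q\<close>, i.e. iff fewer than \<open>r n\<close> of the
  first \<open>n\<close> sample depths exceed \<open>q\<close>. The number of these is a sum of \<open>n\<close> independent Bernoulli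
  variables with mean \<open>\<beta>\<close>, so the central limit theorem applies.
\<close>

text \<open>In a descending list the entries above \<open>q\<close> form an initial segment.
  Position \<open>k\<close>, counted from 0, lies beyond it exactly when its length is at most
  \<open>k\<close>.\<close>

lemma desc_sorted_nth_le_iff:
  fixes ys :: "'a::linorder list"
  assumes "sorted_wrt (\<ge>) ys" "k < length ys"
  shows "ys ! k \<le> q \<longleftrightarrow> length (filter (\<lambda>y. q < y) ys) \<le> k"
  using assms
proof (induction ys arbitrary: k)
  case (Cons y ys)
  have "filter (\<lambda>z. q < z) ys = []" if "y \<le> q"
    using Cons.prems that by (auto simp: filter_empty_conv)
  with Cons show ?case
    by (cases k) (auto simp: not_le not_less nth_Cons)
qed simp

text \<open>Sorting preserves the number of entries above \<open>q\<close>, ties included. Since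
  \<open>r\<close> is at least 1, a count of at most \<open>r - 1\<close> is the same as a count
  below \<open>r\<close>.\<close>

lemma desc_order_stat_le_iff:
  assumes "r \<in> {1..n}"
  shows "desc_order_stat z n r \<le> q \<longleftrightarrow> card {i \<in> {1..n}. q < z i} < r"
proof -
  let ?ys = "rev (sort (map z [1..<Suc n]))"
  have "sorted_wrt (\<ge>) ?ys"
    by (simp add: sorted_wrt_rev del: upt_Suc)
  then have "desc_order_stat z n r \<le> q \<longleftrightarrow> length (filter (\<lambda>y. q < y) ?ys) \<le> r - 1"
    unfolding desc_order_stat_def using assms by (intro desc_sorted_nth_le_iff) auto
  also have "length (filter (\<lambda>y. q < y) ?ys) = length (filter (\<lambda>i. q < z i) [1..<Suc n])"
    by (simp add: rev_filter[symmetric] filter_sort filter_map o_def del: upt_Suc)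
  also have "\<dots> = card {i \<in> {1..n}. q < z i}"
    by (subst distinct_length_filter) (auto intro!: arg_cong[where f = card] simp del: upt_Suc)
  finally show ?thesis
    using assms by auto
qed

text \<open>The sample is indexed from 1, while the central limit theorem takes a sequence indexed
  from 0; this lemma permits the shift by \<open>Suc\<close>.\<close>

lemma (in prob_space) indep_vars_reindex_inj:
  assumes "inj_on f I" "indep_vars N X (f ` I)"
  shows "indep_vars (\<lambda>i. N (f i)) (\<lambda>i. X (f i)) I"
proof -
  have "indep_sets (\<lambda>i. {X (f i) -` A \<inter> space M |A. A \<in> sets (N (f i))}) I"
  proof (rule indep_setsI)
    show "{X (f i) -` A \<inter> space M |A. A \<in> sets (N (f i))} \<subseteq> events" if "i \<in> I" for i
      using assms(2) that by (auto simp: indep_vars_def2 intro!: measurable_sets)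
  next
    fix A J assume J: "J \<noteq> {}" "J \<subseteq> I" "finite J"
      and A: "\<forall>j\<in>J. A j \<in> {X (f j) -` A \<inter> space M |A. A \<in> sets (N (f j))}"
    have inj: "inj_on f J"
      using assms(1) J(2) inj_on_subset by blast
    have "prob (\<Inter>j\<in>f ` J. A (inv_into J f j)) = (\<Prod>j\<in>f ` J. prob (A (inv_into J f j)))"
      using assms(2) J A inj unfolding indep_vars_def2
      by (intro indep_setsD[where I = "f ` I"]) auto
    then show "prob (\<Inter>j\<in>J. A j) = (\<Prod>j\<in>J. prob (A j))"
      using inj by (simp add: prod.reindex)
  qed
  with assms(2) show ?thesis
    by (auto simp: indep_vars_def2)
qed

text \<open>Without atoms the tail function is continuous, so it attains the value
  \<open>\<beta>\<close>. It may be constant on an interval at that height; taking the right end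
  point makes the equivalence hold for every \<open>t\<close>.\<close>

lemma (in real_distribution) ex_upper_quantile:
  assumes "\<And>x. measure M {x} = 0" "0 < \<beta>" "\<beta> < 1"
  obtains q where "measure M {q<..} = \<beta>" "\<And>t. \<beta> \<le> measure M {t<..} \<longleftrightarrow> t \<le> q"
proof -
  let ?S = "\<lambda>t. measure M {t<..}"
  have S: "?S t = 1 - cdf M t" for t
    using prob_compl[of "{..t}"] by (simp add: cdf_def Compl_eq_Diff_UNIV[symmetric])
  have cont: "isCont (cdf M) t" for t
    by (simp add: isCont_cdf assms)
  have anti: "?S t \<le> ?S s" if "s \<le> t" for s t
    using that by (auto intro!: finite_measure_mono)
  \<comment> \<open>Continuity makes \<open>A\<close> closed, and the limits of the distribution
    function at both ends make it nonempty and bounded above, so its supremum belongs to it.\<close>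
  define A where "A = {t. \<beta> \<le> ?S t}"
  have "closed A"
    unfolding A_def S using cont
    by (intro closed_Collect_le continuous_intros continuous_at_imp_continuous_on) auto
  have "eventually (\<lambda>t. 1 - \<beta> < cdf M t) at_top"
    using cdf_lim_at_top_prob assms by (intro order_tendstoD(1)) auto
  then obtain b where b: "1 - \<beta> < cdf M b"
    using eventually_happens by force
  have "eventually (\<lambda>t. cdf M t < 1 - \<beta>) at_bot"
    using cdf_lim_at_bot assms by (intro order_tendstoD(2)) auto
  then obtain a where a: "cdf M a < 1 - \<beta>"
    using eventually_happens by force
  have "t \<le> b" if "t \<in> A" for t
    using that b anti[of b t] by (fastforce simp: A_def S)
  then have bdd: "bdd_above A"
    by (rule bdd_aboveI)
  have "a \<in> A" using a by (simp add: A_def S)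
  define q where "q = Sup A"
  have q: "q \<in> A" "\<And>t. t \<in> A \<Longrightarrow> t \<le> q"
    unfolding q_def using \<open>closed A\<close> \<open>a \<in> A\<close> bdd
    by (auto intro!: closed_contains_Sup cSup_upper)
  have iff: "\<beta> \<le> ?S t \<longleftrightarrow> t \<le> q" for t
    using q anti[of t q] by (force simp: A_def)
  \<comment> \<open>Points to the right of \<open>q\<close> lie outside \<open>A\<close>, so the
    tail there is below \<open>\<beta>\<close>; continuity passes the bound on to
    \<open>q\<close>.\<close>
  have "(?S \<longlongrightarrow> ?S q) (at_right q)"
    unfolding S using cont[of q] by (intro tendsto_intros) (simp add: isCont_def filterlim_at_split)
  moreover have "eventually (\<lambda>t. ?S t \<le> \<beta>) (at_right q)"
    using eventually_at_right_less[of q] by eventually_elim (meson iff linear not_le)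
  ultimately have "?S q \<le> \<beta>"
    by (intro tendsto_upperbound) auto
  then have "?S q = \<beta>"
    using iff[of q] by simp
  then show ?thesis
    using iff by (rule that)
qed

text \<open>Weak convergence gives limits at fixed points only, but the threshold in the application
  moves with \<open>n\<close>. Monotonicity compares it with a fixed \<open>y\<close> near
  \<open>l\<close>, and continuity of the limit makes the error small.\<close>

lemma weak_conv_m_tendsto_cdf:
  assumes "weak_conv_m \<mu> \<nu>" "\<And>n. real_distribution (\<mu> n)" "real_distribution \<nu>"
    and "\<And>x. measure \<nu> {x} = 0" "x \<longlonglongrightarrow> l"
  shows "(\<lambda>n. cdf (\<mu> n) (x n)) \<longlonglongrightarrow> cdf \<nu> l"
proof -
  interpret \<nu>: real_distribution \<nu> by fact
  have cont: "isCont (cdf \<nu>) y" for y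
    by (simp add: \<nu>.isCont_cdf assms)
  have lim: "(\<lambda>n. cdf (\<mu> n) y) \<longlonglongrightarrow> cdf \<nu> y" for y
    using assms(1) cont by (simp add: weak_conv_m_def weak_conv_def)
  have mono: "cdf (\<mu> n) y \<le> cdf (\<mu> n) z" if "y \<le> z" for n y z
  proof -
    interpret real_distribution "\<mu> n" by fact
    show ?thesis using that by (rule cdf_nondecreasing)
  qed
  show ?thesis
  proof (rule order_tendstoI)
    fix a assume "a < cdf \<nu> l"
    then have "eventually (\<lambda>y. a < cdf \<nu> y) (at_left l)"
      using cont[of l] by (intro order_tendstoD(1)) (auto simp: isCont_def filterlim_at_split)
    then obtain y where y: "a < cdf \<nu> y" "y < l"
      by (auto simp: eventually_at_left_field dest: dense)
    show "\<forall>\<^sub>F n in sequentially. a < cdf (\<mu> n) (x n)"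
      using order_tendstoD(1)[OF lim y(1)] order_tendstoD(1)[OF assms(5) y(2)]
      by eventually_elim (rule less_le_trans[OF _ mono], auto)
  next
    fix a assume "cdf \<nu> l < a"
    then have "eventually (\<lambda>y. cdf \<nu> y < a) (at_right l)"
      using cont[of l] by (intro order_tendstoD(2)) (auto simp: isCont_def filterlim_at_split)
    then obtain y where y: "cdf \<nu> y < a" "l < y"
      by (auto simp: eventually_at_right_field dest: dense)
    show "\<forall>\<^sub>F n in sequentially. cdf (\<mu> n) (x n) < a"
      using order_tendstoD(2)[OF lim y(1)] order_tendstoD(2)[OF assms(5) y(2)]
      by eventually_elim (rule le_less_trans[OF mono], auto)
  qed
qed

lemma measure_std_normal_singleton: "measure std_normal_distribution {x} = 0"
proof -
  have "{x} \<in> null_sets lborel"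
    by (simp add: finite_imp_null_set_lborel)
  then have "{x} \<in> null_sets std_normal_distribution"
    using absolutely_continuousI_density[of "\<lambda>x. ennreal (std_normal_density x)" lborel]
    by (auto simp: absolutely_continuous_def)
  then show ?thesis
    by (simp add: null_setsD1 measure_def)
qed

text \<open>The count is a sum of independent Bernoulli variables. Standardizing it turns the event
  into \<open>T n \<le> x n\<close> with deterministic thresholds \<open>x n\<close> tending to
  \<open>c\<close>.\<close>

lemma (in prob_space) prob_card_less_tendsto:
  assumes indep: "indep_vars (\<lambda>_. N) X {1..}"
    and distr: "\<And>i. 1 \<le> i \<Longrightarrow> distr M N (X i) = \<mu>"
    and A: "A \<in> sets N" "measure \<mu> A = \<beta>"
    and \<beta>: "0 < \<beta>" "\<beta> < 1"
    and k: "(\<lambda>n. sqrt (real n) * (real (k n) / real n - \<beta>)) \<longlonglongrightarrow> c * sqrt (\<beta> * (1 - \<beta>))"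
  shows "(\<lambda>n. prob {\<omega> \<in> space M. card {i \<in> {1..n}. X i \<omega> \<in> A} < k n})
           \<longlonglongrightarrow> cdf std_normal_distribution c"
proof -
  define \<sigma> where "\<sigma> = sqrt (\<beta> * (1 - \<beta>))"
  have \<sigma>: "0 < \<sigma>" "\<sigma>\<^sup>2 = \<beta> * (1 - \<beta>)"
    using \<beta> by (auto simp: \<sigma>_def)
  have X [measurable]: "X (Suc i) \<in> measurable M N" for i
    using indep by (auto simp: indep_vars_def2)
  note A(1) [measurable]
  define Y :: "nat \<Rightarrow> 'a \<Rightarrow> real" where "Y i \<omega> = indicator A (X (Suc i) \<omega>)" for i \<omega>
  have Y [measurable]: "Y i \<in> borel_measurable M" for i
    unfolding Y_def by measurable
  \<comment> \<open>Indicators are idempotent, so the second moment is the mean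
    \<open>\<beta>\<close>; this yields both the variance and square integrability.\<close>
  have Y_sq: "(\<lambda>\<omega>. (Y i \<omega>)\<^sup>2) = Y i" for i
    by (auto simp: Y_def fun_eq_iff indicator_def)
  have Y_int: "integrable M (Y i)" for i
    by (rule integrable_const_bound[where B = 1]) (auto simp: Y_def indicator_def)
  have Y_mean: "expectation (Y i) = \<beta>" for i
  proof -
    have "expectation (Y i) = measure (distr M N (X (Suc i))) A"
      unfolding Y_def by (subst integral_distr[symmetric, where N = N]) auto
    with distr A show ?thesis by simp
  qed
  have Y_var: "variance (Y i) = \<sigma>\<^sup>2" for i
    using Y_int by (subst variance_eq) (simp_all add: Y_sq Y_mean \<sigma>, simp add: power2_eq_square algebra_simps)
  have Y_distr: "distr M borel (Y i) = distr \<mu> borel (indicator A)" for i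
    unfolding distr[of "Suc i", symmetric, simplified]
    by (subst distr_distr) (auto simp: Y_def[abs_def] comp_def)
  have "indep_vars (\<lambda>_. borel) Y UNIV"
    unfolding Y_def[abs_def]
    by (rule indep_vars_compose2[OF indep_vars_reindex_inj[where f = Suc]])
       (auto intro!: indep_vars_subset[OF indep])
  define T where "T n \<omega> = (\<Sum>i<n. Y i \<omega> - \<beta>) / sqrt (n * \<sigma>\<^sup>2)" for n \<omega>
  have T [measurable]: "T n \<in> borel_measurable M" for n
    unfolding T_def[abs_def] by measurable
  have conv: "weak_conv_m (\<lambda>n. distr M borel (T n)) std_normal_distribution"
    unfolding T_def
    by (rule central_limit_theorem) (use \<open>indep_vars _ Y _\<close> Y_mean \<sigma> Y_int Y_var Y_distr in \<open>auto simp: Y_sq\<close>)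
  \<comment> \<open>The \<open>- 1\<close>, taken in the reals, rewrites \<open>card < k n\<close>
    as a non-strict inequality, as a distribution function requires. After scaling it contributes a
    term of order \<open>1 / sqrt n\<close>, which vanishes.\<close>
  define x where "x n = (real (k n) - 1 - n * \<beta>) / sqrt (n * \<sigma>\<^sup>2)" for n
  have "x \<longlonglongrightarrow> c"
  proof -
    have "(\<lambda>n. 1 / sqrt (real n)) \<longlonglongrightarrow> 0"
      by (intro real_tendsto_divide_at_top[OF tendsto_const]
          filterlim_compose[OF sqrt_at_top filterlim_real_sequentially])
    from tendsto_divide[OF tendsto_diff[OF k this] tendsto_const, of \<sigma>]
    have "(\<lambda>n. (sqrt n * (real (k n) / n - \<beta>) - 1 / sqrt n) / \<sigma>) \<longlonglongrightarrow> c"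
      using \<sigma>(1) unfolding \<sigma>_def[symmetric] by simp
    moreover have "\<forall>\<^sub>F n in sequentially. (sqrt n * (real (k n) / n - \<beta>) - 1 / sqrt n) / \<sigma> = x n"
      using eventually_gt_at_top[of 0]
    proof eventually_elim
      case (elim n)
      have "sqrt n * (real (k n) / n - \<beta>) = (real (k n) - n * \<beta>) / sqrt n"
        using elim by (simp add: field_simps)
      then show ?case
        using \<sigma>(1) by (simp add: x_def real_sqrt_mult diff_divide_distrib)
    qed
    ultimately show ?thesis
      by (rule Lim_transform_eventually)
  qed
  then have lim: "(\<lambda>n. cdf (distr M borel (T n)) (x n)) \<longlonglongrightarrow> cdf std_normal_distribution c"
    by (intro weak_conv_m_tendsto_cdf conv real_distribution_distr T real_dist_normal_dist
        measure_std_normal_singleton)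
  \<comment> \<open>For \<open>n = 0\<close> both \<open>T n\<close> and \<open>x n\<close> are 0 by
    division by zero, so the events are compared only for positive \<open>n\<close>.\<close>
  have "\<forall>\<^sub>F n in sequentially. cdf (distr M borel (T n)) (x n)
          = prob {\<omega> \<in> space M. card {i \<in> {1..n}. X i \<omega> \<in> A} < k n}"
    using eventually_gt_at_top[of 0]
  proof eventually_elim
    case (elim n)
    have sum: "(\<Sum>i<n. Y i \<omega>) = card {i \<in> {1..n}. X i \<omega> \<in> A}" for \<omega>
    proof -
      have "(\<Sum>i<n. Y i \<omega>) = (\<Sum>i\<in>{1..n}. indicator A (X i \<omega>))"
        unfolding Y_def by (rule sum.reindex_bij_witness[of _ "\<lambda>i. i - 1" Suc]) auto
      also have "\<dots> = (\<Sum>i\<in>{1..n}. if X i \<omega> \<in> A then 1 else 0)"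
        by (intro sum.cong) auto
      also have "\<dots> = card {i \<in> {1..n}. X i \<omega> \<in> A}"
        by (subst sum.inter_filter[symmetric]) auto
      finally show ?thesis .
    qed
    have "T n \<omega> \<le> x n \<longleftrightarrow> card {i \<in> {1..n}. X i \<omega> \<in> A} < k n" for \<omega>
    proof -
      have "T n \<omega> \<le> x n \<longleftrightarrow> real (card {i \<in> {1..n}. X i \<omega> \<in> A}) \<le> real (k n) - 1"
        using elim \<sigma>(1) by (simp add: T_def x_def sum sum_subtractf divide_le_cancel mult_less_0_iff)
      also have "\<dots> \<longleftrightarrow> card {i \<in> {1..n}. X i \<omega> \<in> A} < k n"
        by linarith
      finally show ?thesis .
    qed
    then have "T n -` {..x n} \<inter> space M = {\<omega> \<in> space M. card {i \<in> {1..n}. X i \<omega> \<in> A} < k n}"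
      by blast
    then show ?case
      by (simp only: cdf_def measure_distr[OF T atMost_borel])
  qed
  with lim show ?thesis
    by (rule Lim_transform_eventually)
qed

text \<open>Continuity of \<open>F\<close> does not carry over to the law of the depth: a constant
  depth has an atom. Hence \<open>depth_law_cont\<close> is stated as a hypothesis, as is
  measurability of \<open>D F\<close>.\<close>

theorem theorem3p2:
  fixes F :: "(real ^ 'p) measure"
    and D :: "(real ^ 'p) measure \<Rightarrow> real ^ 'p \<Rightarrow> real"
    and M :: "'w measure"
    and X :: "nat \<Rightarrow> 'w \<Rightarrow> real ^ 'p"
    and r :: "nat \<Rightarrow> nat"
    and \<beta> \<gamma> \<xi> :: real
  assumes dim: "2 \<le> CARD('p)"
    and F_cont: "continuous_distribution F"
    and depth: "data_depth D"
    and depth_measurable: "D F \<in> borel_measurable borel"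
    and depth_law_cont: "continuous_distribution (distr F borel (D F))"
    and M: "prob_space M"
    and X_indep: "prob_space.indep_vars M (\<lambda>_. borel) X {1..}"
    and X_distr: "\<And>i. 1 \<le> i \<Longrightarrow> distr M borel (X i) = F"
    and beta: "0 < \<beta>" "\<beta> < 1"
    and gamma: "0 < \<gamma>" "\<gamma> < 1"
    and xi: "cdf std_normal_distribution \<xi> = \<gamma>"
    and r_range: "\<And>n. 1 \<le> n \<Longrightarrow> r n \<in> {1..n}"
    and r_lim: "(\<lambda>n. sqrt (real n) * (real (r n) / real n - \<beta>))
                  \<longlonglongrightarrow> \<xi> * sqrt (\<beta> * (1 - \<beta>))"
  shows "(\<lambda>n. measure M {\<omega> \<in> space M.
            measure F (tolerance_region D F (\<lambda>i. X i \<omega>) n (r n)) \<ge> \<beta>})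
         \<longlonglongrightarrow> \<gamma>"
proof -
  interpret M: prob_space M by fact
  interpret F: prob_space F
    using F_cont by (simp add: continuous_distribution_def prob_distribution_def)
  have sets_F [measurable_cong]: "sets F = sets borel"
    using F_cont by (simp add: continuous_distribution_def prob_distribution_def)
  note depth_measurable [measurable]
  have D: "D F \<in> borel_measurable F"
    by measurable
  then interpret G: real_distribution "distr F borel (D F)"
    by (rule F.real_distribution_distr)
  \<comment> \<open>Measures of depth regions are tails of the real law of the depth, which reduces
    the problem to one dimension.\<close>
  have tail: "measure (distr F borel (D F)) {t<..} = measure F {x. t < D F x}" for t
    using D sets_eq_imp_space_eq[OF sets_F]
    by (subst measure_distr) (auto intro!: arg_cong[where f = "measure F"])
  obtain q where q: "measure F {x. q < D F x} = \<beta>"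
    and q_iff: "\<And>t. \<beta> \<le> measure F {x. t < D F x} \<longleftrightarrow> t \<le> q"
    using G.ex_upper_quantile[OF _ beta] depth_law_cont
    by (auto simp: tail continuous_distribution_def)
  have "(\<lambda>n. measure M {\<omega> \<in> space M. card {i \<in> {1..n}. X i \<omega> \<in> {x. q < D F x}} < r n})
          \<longlonglongrightarrow> cdf std_normal_distribution \<xi>"
    by (rule M.prob_card_less_tendsto[OF X_indep X_distr _ q beta r_lim]) measurable
  moreover have "\<forall>\<^sub>F n in sequentially.
      measure M {\<omega> \<in> space M. card {i \<in> {1..n}. X i \<omega> \<in> {x. q < D F x}} < r n}
    = measure M {\<omega> \<in> space M. measure F (tolerance_region D F (\<lambda>i. X i \<omega>) n (r n)) \<ge> \<beta>}"
    using eventually_ge_at_top[of 1]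
  proof eventually_elim
    case (elim n)
    show ?case
      \<comment> \<open>As \<open>q_iff\<close> holds at every level, it applies to the random level
        given by the order statistic. The two events are therefore equal as sets for each
        \<open>n \<ge> 1\<close>.\<close>
      unfolding tolerance_region_def depth_region_def q_iff
        desc_order_stat_le_iff[OF r_range[OF elim]] mem_Collect_eq ..
  qed
  ultimately show ?thesis
    unfolding xi by (rule Lim_transform_eventually)
qed

end
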